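(* Let $H\le F$ be a non-trivial subgroup, let $T$ be a geodesic spanning tree (with respect to $o=H$) of the Schreier graph $X=H\backslash F$, and let $\Delta\subset\partial F$ be the associated Schreier fundamental domain. Then the sequence $$a_n=\frac{|S_X^n|}{|S_F^n|}=\frac{|S_X^n|}{2m(2m-1)^{n-1}},\qquad n\ge 1,$$ is monotonically decreasing (in the non-strict sense) and converges to $\mathfrak m(\Delta)$.
   Context: $F$ is the free group freely generated by a finite set $\mathcal A$ with $|\mathcal A|=m\ge 2$; $\breve{\mathcal A}=\mathcal A\sqcup\mathcal A^{-1}$. Elements $g\in F$ are identified with finite freely reduced words in $\breve{\mathcal A}$, $|g|$ is the length. $\partial F$ is the set of infinite freely reduced words with the product topology. The uniform measure $\mathfrak m$ is the Borel probability measure on $\partial F$ for which the set of infinite words beginning with $g$ has measure $\frac1{2m(2m-1)^{|g|-1}}$ for every $g\ne e$. The Schreier graph $X=H\backslash F$ has the cosets $Hg$ as vertices and, for each vertex $x$ and $a\in\breve{\mathcal A}$, an oriented edge from $x$ to $xa$ labelled $a$, whose reversal is the edge from $xa$ to $x$ labelled $a^{-1}$ (loops and multiple edges allowed); $o=H$. $S_F^n$ and $S_X^n$ are the spheres of radius $n$ in the Cayley graph of $F$ centered at $e$ and in $X$ centered at $o$, respectively. A spanning tree $T$ of $X$ is geodesic if $d_T(o,x)=d_X(o,x)$ for all vertices $x$. For every oriented edge $\mathcal E=[x,y]$ of $X$ not in $T$, let $\sigma_-(\mathcal E)$ be the word read along the geodesic from $o$ to $x$ in $T$ and $\sigma_0(\mathcal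 E)\in\breve{\mathcal A}$ the label of $\mathcal E$. The Schreier fundamental domain $\Delta$ is the set of infinite words in $\partial F$ which do not begin with any of the words $\sigma_-(\mathcal E)\sigma_0(\mathcal E)$, where $\mathcal E$ runs over all oriented edges of $X$ not in $T$. *)

theory Defs
  imports
    "HOL-Probability.Probability"
    "HOL-Algebra.Coset"
    "HOL-Library.Extended_Nat"
    "Graph_Theory.Arc_Walk"
    "Graph_Theory.Digraph_Component"
begin

section \<open>The free group as the group of freely reduced words\<close>

text \<open>The letter \<open>(a, True)\<close> is the generator \<open>a\<close>, and \<open>(a, False)\<close> is its inverse.\<close>

type_synonym 'a letter = "'a \<times> bool"

definition letters :: "'a set \<Rightarrow> 'a letter set" where
  "letters A = A \<times> UNIV"

definition letter_inv :: "'a letter \<Rightarrow> 'a letter" where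
  "letter_inv x = (fst x, \<not> snd x)"

definition freely_reduced :: "'a letter list \<Rightarrow> bool" where
  "freely_reduced w \<longleftrightarrow> successively (\<lambda>x y. y \<noteq> letter_inv x) w"

text \<open>Left multiplication of a reduced word by a letter, followed by the only possible
  cancellation.\<close>

fun red_cons :: "'a letter \<Rightarrow> 'a letter list \<Rightarrow> 'a letter list" where
  "red_cons x [] = [x]"
| "red_cons x (y # w) = (if y = letter_inv x then w else x # y # w)"

definition free_group :: "'a set \<Rightarrow> 'a letter list monoid" where
  "free_group A =
     \<lparr>carrier = {w. set w \<subseteq> letters A \<and> freely_reduced w},
      mult = (\<lambda>u v. foldr red_cons u v),
      one = []\<rparr>"

lemma letter_inv_invol [simp]: "letter_inv (letter_inv x) = x"
  by (simp add: letter_inv_def)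

lemma letter_inv_neq [simp]: "letter_inv x \<noteq> x"
  by (cases x) (simp add: letter_inv_def)

lemma letter_inv_in_letters [simp]: "letter_inv x \<in> letters A \<longleftrightarrow> x \<in> letters A"
  by (cases x) (simp add: letter_inv_def letters_def)

lemma reduced_Nil [simp]: "freely_reduced []"
  by (simp add: freely_reduced_def)

lemma reduced_ConsD: "freely_reduced (x # w) \<Longrightarrow> freely_reduced w"
  by (cases w) (auto simp: freely_reduced_def)

lemma reduced_red_cons: "freely_reduced w \<Longrightarrow> freely_reduced (red_cons x w)"
  by (cases w) (auto simp: freely_reduced_def split: if_splits dest: reduced_ConsD[unfolded freely_reduced_def])

lemma red_cons_cancel: "freely_reduced w \<Longrightarrow> red_cons x (red_cons (letter_inv x) w) = w"
  by (cases w rule: remdups_adj.cases) (auto simp: freely_reduced_def)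

lemma red_cons_reduced: "freely_reduced (x # w) \<Longrightarrow> red_cons x w = x # w"
  by (cases w) (auto simp: freely_reduced_def)

lemma reduced_foldr: "freely_reduced v \<Longrightarrow> freely_reduced (foldr red_cons u v)"
  by (induction u) (auto intro: reduced_red_cons)

lemma foldr_red_cons:
  "freely_reduced v \<Longrightarrow> foldr red_cons (red_cons x u) v = red_cons x (foldr red_cons u v)"
proof (cases u)
  case (Cons y w)
  assume "freely_reduced v"
  then show ?thesis
    using Cons red_cons_cancel[OF reduced_foldr, of v x w] by auto
qed simp

lemma foldr_red_cons_assoc:
  "freely_reduced w \<Longrightarrow> foldr red_cons (foldr red_cons u v) w = foldr red_cons u (foldr red_cons v w)"
  by (induction u) (auto simp: foldr_red_cons)

lemma foldr_red_cons_Nil: "freely_reduced w \<Longrightarrow> foldr red_cons w [] = w"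
proof (induction w)
  case (Cons x w)
  then show ?case
    using reduced_ConsD[of x w] red_cons_reduced[of x w] by simp
qed simp

lemma set_red_cons: "set (red_cons x w) \<subseteq> insert x (set w)"
  by (cases w) auto

lemma set_foldr_red_cons: "set (foldr red_cons u v) \<subseteq> set u \<union> set v"
  by (induction u) (use set_red_cons in fastforce)+

lemma free_group_left_inverse:
  assumes "freely_reduced w"
  shows "foldr red_cons (foldr red_cons (rev (map letter_inv w)) []) w = []"
proof -
  have "foldr red_cons (rev (map letter_inv w)) w = []"
    by (induction w) auto
  then show ?thesis
    using assms by (subst foldr_red_cons_assoc) auto
qed

lemma group_free_group: "group (free_group A)"
proof (rule groupI, goal_cases)
  case (1 x y)
  then show ?case
    using set_foldr_red_cons[of x y] by (auto simp: free_group_def reduced_foldr)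
next
  case (5 x)
  let ?y = "foldr red_cons (rev (map letter_inv x)) []"
  have "set ?y \<subseteq> letters A"
    using 5 set_foldr_red_cons[of "rev (map letter_inv x)" "[]"]
    by (force simp: free_group_def simp del: split_paired_All)
  then have "?y \<in> carrier (free_group A)"
    by (simp add: free_group_def reduced_foldr)
  then show ?case
    using 5 free_group_left_inverse[of x] by (auto simp: free_group_def)
qed (auto simp: free_group_def foldr_red_cons_assoc)

section \<open>The boundary of the free group and its uniform measure\<close>

definition boundary :: "'a set \<Rightarrow> (nat \<Rightarrow> 'a letter) set" where
  "boundary A = {\<xi>. \<forall>n. \<xi> n \<in> letters A \<and> \<xi> (Suc n) \<noteq> letter_inv (\<xi> n)}"

definition boundary_topology :: "'a set \<Rightarrow> (nat \<Rightarrow> 'a letter) topology" where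
  "boundary_topology A =
     subtopology (product_topology (\<lambda>_. discrete_topology (letters A)) UNIV) (boundary A)"

definition begins_with :: "(nat \<Rightarrow> 'a letter) \<Rightarrow> 'a letter list \<Rightarrow> bool" where
  "begins_with \<xi> w \<longleftrightarrow> (\<forall>i<length w. \<xi> i = w ! i)"

text \<open>These properties determine \<open>M\<close> uniquely, since the sets of words with a prescribed beginning
  form a countable base of the topology that is closed under intersections up to the empty set.\<close>

definition is_uniform_measure :: "'a set \<Rightarrow> (nat \<Rightarrow> 'a letter) measure \<Rightarrow> bool" where
  "is_uniform_measure A M \<longleftrightarrow>
     prob_space M \<and>
     space M = boundary A \<and>
     sets M = sigma_sets (boundary A) {U. openin (boundary_topology A) U} \<and>
     (\<forall>g\<in>carrier (free_group A). g \<noteq> \<one>\<^bsub>free_group A\<^esub> \<longrightarrow>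
        measure M {\<xi>\<in>boundary A. begins_with \<xi> g} =
          1 / (2 * real (card A) * (2 * real (card A) - 1) ^ (length g - 1)))"

section \<open>Distances, spheres and trees in multigraphs\<close>

text \<open>A graph is a \<open>pre_digraph\<close> whose arcs are the oriented edges.\<close>

definition graph_dist :: "('v, 'e) pre_digraph \<Rightarrow> 'v \<Rightarrow> 'v \<Rightarrow> enat" where
  "graph_dist G u v = (INF p\<in>{p. pre_digraph.awalk G u p v}. enat (length p))"

definition geodesic :: "('v, 'e) pre_digraph \<Rightarrow> 'v \<Rightarrow> 'e list \<Rightarrow> 'v \<Rightarrow> bool" where
  "geodesic G u p v \<longleftrightarrow> pre_digraph.awalk G u p v \<and> enat (length p) = graph_dist G u v"

definition graph_sphere :: "('v, 'e) pre_digraph \<Rightarrow> 'v \<Rightarrow> nat \<Rightarrow> 'v set" where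
  "graph_sphere G u n = {v \<in> verts G. graph_dist G u v = enat n}"

text \<open>The tree predicate of \<open>Graph_Theory\<close> is not applicable: there, an edge followed by
  its reversal counts as a cycle. Below, \<open>\<iota>\<close> is the reversal of oriented edges, and a circuit is
  a closed path without repeated vertices that does not traverse an edge back and forth.
  Loops and pairs of parallel edges give circuits of length 1 and 2.\<close>

definition circuit :: "('v, 'e) pre_digraph \<Rightarrow> ('e \<Rightarrow> 'e) \<Rightarrow> 'e list \<Rightarrow> bool" where
  "circuit G \<iota> p \<longleftrightarrow>
     p \<noteq> [] \<and>
     pre_digraph.awalk G (tail G (hd p)) p (tail G (hd p)) \<and>
     distinct (map (tail G) p) \<and>
     successively (\<lambda>e f. f \<noteq> \<iota> e) p"

definition spanning_tree_of ::
    "('v, 'e) pre_digraph \<Rightarrow> ('e \<Rightarrow> 'e) \<Rightarrow> ('v, 'e) pre_digraph \<Rightarrow> bool" where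
  "spanning_tree_of G \<iota> T \<longleftrightarrow>
     spanning T G \<and>
     (\<forall>e\<in>arcs T. \<iota> e \<in> arcs T) \<and>
     Digraph_Component.connected T \<and>
     (\<nexists>p. circuit T \<iota> p)"

section \<open>Cayley graph, Schreier graph and Schreier fundamental domain\<close>

definition cayley_graph ::
    "'a set \<Rightarrow> ('a letter list, 'a letter list \<times> 'a letter) pre_digraph" where
  "cayley_graph A =
     \<lparr>verts = carrier (free_group A),
      arcs = carrier (free_group A) \<times> letters A,
      tail = fst,
      head = (\<lambda>(g, a). g \<otimes>\<^bsub>free_group A\<^esub> [a])\<rparr>"

text \<open>The pair \<open>(x, a)\<close> is the oriented edge labelled \<open>a\<close> that starts at the coset \<open>x\<close>.\<close>

type_synonym 'a schreier_edge = "'a letter list set \<times> 'a letter"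

definition schreier_graph ::
    "'a set \<Rightarrow> 'a letter list set \<Rightarrow> ('a letter list set, 'a schreier_edge) pre_digraph" where
  "schreier_graph A H =
     \<lparr>verts = rcosets\<^bsub>free_group A\<^esub> H,
      arcs = (rcosets\<^bsub>free_group A\<^esub> H) \<times> letters A,
      tail = fst,
      head = (\<lambda>(x, a). x #>\<^bsub>free_group A\<^esub> [a])\<rparr>"

definition schreier_reversal ::
    "'a set \<Rightarrow> 'a schreier_edge \<Rightarrow> 'a schreier_edge" where
  "schreier_reversal A = (\<lambda>(x, a). (x #>\<^bsub>free_group A\<^esub> [a], letter_inv a))"

definition geodesic_spanning_tree ::
    "'a set \<Rightarrow> 'a letter list set \<Rightarrow> ('a letter list set, 'a schreier_edge) pre_digraph \<Rightarrow> bool" where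
  "geodesic_spanning_tree A H T \<longleftrightarrow>
     spanning_tree_of (schreier_graph A H) (schreier_reversal A) T \<and>
     (\<forall>x\<in>verts (schreier_graph A H). graph_dist T H x = graph_dist (schreier_graph A H) H x)"

definition sigma_minus ::
    "'a letter list set \<Rightarrow> ('a letter list set, 'a schreier_edge) pre_digraph
      \<Rightarrow> 'a schreier_edge \<Rightarrow> 'a letter list" where
  "sigma_minus H T e = map snd (THE p. geodesic T H p (fst e))"

definition sigma_zero :: "'a schreier_edge \<Rightarrow> 'a letter" where
  "sigma_zero e = snd e"

definition schreier_domain ::
    "'a set \<Rightarrow> 'a letter list set \<Rightarrow> ('a letter list set, 'a schreier_edge) pre_digraph
      \<Rightarrow> (nat \<Rightarrow> 'a letter) set" where
  "schreier_domain A H T =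
     {\<xi> \<in> boundary A. \<forall>e \<in> arcs (schreier_graph A H) - arcs T.
        \<not> begins_with \<xi> (sigma_minus H T e @ [sigma_zero e])}"

end

theory Submission
  imports Defs
begin

text \<open>In a circuit-free graph a walk without backtracking is determined by its endpoints, so the
  reduced words of length \<open>n\<close> whose walk from the root stays in the geodesic tree are in bijection
  with the sphere of radius \<open>n\<close> of the Schreier graph. Hence \<open>a\<^sub>n\<close> is the measure of the set
  \<open>\<Omega>\<^sub>n\<close> of infinite words whose beginning of length \<open>n\<close> is such a word. The sets \<open>\<Omega>\<^sub>n\<close> decrease
  and their intersection is the fundamental domain.\<close>

section \<open>Walks in circuit-free graphs\<close>

text \<open>Walk lengths are natural numbers, so a finite infimum is attained; the infimum is
  \<infinity> exactly when there is no walk.\<close>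

lemma geodesic_exists:
  assumes "graph_dist G u v \<noteq> \<infinity>"
  shows "\<exists>p. geodesic G u p v"
proof -
  have "{p. pre_digraph.awalk G u p v} \<noteq> {}"
    using assms unfolding graph_dist_def by (metis image_empty Inf_empty top_enat_def)
  then obtain p where "pre_digraph.awalk G u p v"
    and "\<And>q. pre_digraph.awalk G u q v \<Longrightarrow> length p \<le> length q"
    using ex_has_least_nat[of "\<lambda>p. pre_digraph.awalk G u p v" _ length] by blast
  then show ?thesis
    unfolding geodesic_def graph_dist_def
    by (intro exI[of _ p] conjI antisym INF_greatest INF_lower) auto
qed

lemma graph_dist_le:
  "pre_digraph.awalk G u p v \<Longrightarrow> graph_dist G u v \<le> enat (length p)"
  unfolding graph_dist_def by (intro INF_lower) auto

locale involutive_digraph = wf_digraph G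
  for G :: "('v, 'e) pre_digraph" +
  fixes \<iota> :: "'e \<Rightarrow> 'e"
  assumes inv_arcs: "e \<in> arcs G \<Longrightarrow> \<iota> e \<in> arcs G"
    and inv_inv: "e \<in> arcs G \<Longrightarrow> \<iota> (\<iota> e) = e"
    and tail_inv: "e \<in> arcs G \<Longrightarrow> tail G (\<iota> e) = head G e"
begin

abbreviation nonbacktracking :: "'e list \<Rightarrow> bool" where
  "nonbacktracking \<equiv> successively (\<lambda>e f. f \<noteq> \<iota> e)"

lemma head_inv: "e \<in> arcs G \<Longrightarrow> head G (\<iota> e) = tail G e"
  using tail_inv[of "\<iota> e"] inv_arcs inv_inv by auto

lemma awalk_rev:
  "awalk u p v \<Longrightarrow> awalk v (rev (map \<iota> p)) u"
proof (induction p arbitrary: u)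
  case Nil
  then show ?case by (auto simp: awalk_Nil_iff)
next
  case (Cons e p)
  then have e: "e \<in> arcs G" "u = tail G e" and "awalk (head G e) p v"
    by (auto simp: awalk_Cons_iff)
  with Cons.IH have "awalk v (rev (map \<iota> p)) (head G e)" by blast
  moreover have "awalk (head G e) [\<iota> e] u"
    using e by (simp add: awalk_Cons_iff awalk_Nil_iff inv_arcs tail_inv head_inv)
  ultimately show ?case by auto
qed

text \<open>Consecutive arcs \<open>e\<close>, \<open>f\<close> become \<open>\<iota> f\<close>,
  \<open>\<iota> e\<close>, and the condition on the new pair reduces to the old one because
  \<open>\<iota>\<close> is involutive on arcs.\<close>

lemma nonbacktracking_rev:
  assumes "set p \<subseteq> arcs G" "nonbacktracking p"
  shows "nonbacktracking (rev (map \<iota> p))"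
  unfolding successively_rev successively_map
  using assms(2) by (rule successively_mono) (use assms(1) inv_inv in force)

text \<open>A shortest nonempty closed subwalk has no repeated vertex.\<close>

lemma circuit_in_closed_walk:
  assumes "awalk u p u" "p \<noteq> []" "nonbacktracking p"
  shows "\<exists>c. circuit G \<iota> c"
  using assms
proof (induction "length p" arbitrary: u p rule: less_induct)
  case less
  show ?case
  proof (cases "distinct (map (tail G) p)")
    case True
    moreover have "u = tail G (hd p)"
      using less.prems by (cases p) (auto simp: awalk_Cons_iff)
    ultimately show ?thesis
      using less.prems unfolding circuit_def by blast
  next
    case False
    then obtain xs ys zs x where "map (tail G) p = xs @ [x] @ ys @ [x] @ zs"
      using not_distinct_decomp by blast
    then obtain p1 e p2 f p3 where p: "p = p1 @ e # p2 @ f # p3" and tl: "tail G e = tail G f"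
      by (fastforce simp: map_eq_append_conv append_eq_map_conv map_eq_Cons_conv Cons_eq_map_conv)
    have "awalk (tail G e) (e # p2) (tail G e)"
      using less.prems(1) p tl by (auto simp: awalk_Cons_iff)
    \<comment> \<open>Nothing has to be checked where the shorter walk closes up:
      \<open>circuit\<close> compares only arcs that are consecutive in the list.\<close>
    moreover have "nonbacktracking (e # p2)"
      using less.prems(3) p by (auto simp: successively_append_iff successively_Cons)
    ultimately show ?thesis
      using less.hyps[of "e # p2"] p by auto
  qed
qed

text \<open>Common last arcs are stripped off by induction. What remains is an empty walk against a
  nonempty closed one, or two walks with different last arcs; both would produce a circuit.\<close>

lemma nonbacktracking_walk_unique:
  assumes "\<nexists>c. circuit G \<iota> c"
    and "awalk u p v" "nonbacktracking p" "awalk u q v" "nonbacktracking q"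
  shows "p = q"
  using assms(2-)
proof (induction p arbitrary: q v rule: rev_induct)
  case Nil
  then show ?case
    using circuit_in_closed_walk assms(1) by (metis awalk_empty_ends)
next
  case (snoc e p)
  show ?case
  proof (cases q rule: rev_cases)
    case Nil
    then show ?thesis
      using snoc.prems circuit_in_closed_walk assms(1) by (metis awalk_empty_ends)
  next
    case q: (snoc q' f)
    \<comment> \<open>If the last arcs differ, then \<open>p @ [e]\<close> followed by the reversal of \<open>q\<close> is a closed walk
      without backtracking.\<close>
    have arcs: "e \<in> arcs G" "f \<in> arcs G" "set q \<subseteq> arcs G"
      using snoc.prems q by (auto simp: awalk_def)
    show ?thesis
    proof (cases "e = f")
      case True
      have "awalk u p (tail G e)" "awalk u q' (tail G e)"
        using snoc.prems q True by (auto simp: awalk_Cons_iff)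
      then have "p = q'"
        using snoc.prems q by (intro snoc.IH) (auto simp: successively_append_iff)
      then show ?thesis using q True by simp
    next
      case False
      let ?c = "(p @ [e]) @ rev (map \<iota> q)"
      have "awalk u ?c u"
        using awalk_appendI[OF snoc.prems(1) awalk_rev[OF snoc.prems(3)]] .
      moreover have "nonbacktracking (rev (map \<iota> q))"
        using arcs snoc.prems by (intro nonbacktracking_rev)
      \<comment> \<open>At the junction \<open>e\<close> is followed by \<open>\<iota> f\<close>,
        and \<open>\<iota> f = \<iota> e\<close> would give \<open>e = f\<close>.\<close>
      then have "nonbacktracking ?c"
        unfolding successively_append_iff[of _ "p @ [e]"]
        using snoc.prems(2) False arcs q inv_inv[of e] inv_inv[of f] by auto
      ultimately show ?thesis
        using circuit_in_closed_walk assms(1) by blast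
    qed
  qed
qed

text \<open>Deleting an arc together with an immediately following reversal leaves a walk with the
  same endpoints that is shorter by two.\<close>

lemma geodesic_nonbacktracking:
  assumes "geodesic G u p v"
  shows "nonbacktracking p"
proof (rule ccontr)
  assume "\<not> nonbacktracking p"
  then obtain p1 e p2 where p: "p = p1 @ e # \<iota> e # p2"
    by (auto simp: successively_conv_nth) (metis id_take_nth_drop Cons_nth_drop_Suc Suc_lessD)
  have "awalk u (p1 @ p2) v"
    using assms p by (auto simp: geodesic_def awalk_Cons_iff head_inv)
  then have "graph_dist G u v \<le> enat (length (p1 @ p2))"
    by (rule graph_dist_le)
  then show False
    using assms p unfolding geodesic_def by (metis enat_ord_simps(1) length_append length_Cons
        add_Suc_right Suc_n_not_le_n not_less_eq_eq le_SucI)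
qed

text \<open>The given walk makes the distance finite, so some geodesic joins the same endpoints; by
  uniqueness it is the given walk. This replaces the metric condition in \<open>sigma_minus\<close>
  by a local one.\<close>

lemma geodesic_iff_nonbacktracking:
  assumes "\<nexists>c. circuit G \<iota> c"
  shows "geodesic G u p v \<longleftrightarrow> awalk u p v \<and> nonbacktracking p"
proof
  assume "awalk u p v \<and> nonbacktracking p"
  moreover from this have "graph_dist G u v \<noteq> \<infinity>"
    using graph_dist_le[of G u p v] by (metis enat_ord_code(5))
  then obtain q where q: "geodesic G u q v"
    using geodesic_exists[of G u v] by blast
  moreover have "awalk u q v" "nonbacktracking q"
    using q geodesic_nonbacktracking by (auto simp: geodesic_def)
  ultimately show "geodesic G u p v"
    using nonbacktracking_walk_unique[OF assms] by metis
qed (use geodesic_nonbacktracking in \<open>auto simp: geodesic_def\<close>)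

end

section \<open>Words read along walks\<close>

text \<open>Generic in the transition function \<open>s\<close>, so that it serves the Cayley graph,
  the Schreier graph and the tree, whose arcs are all pairs of a source and a label.\<close>

fun walk_of :: "('v \<Rightarrow> 'l \<Rightarrow> 'v) \<Rightarrow> 'v \<Rightarrow> 'l list \<Rightarrow> ('v \<times> 'l) list" where
  "walk_of s x [] = []"
| "walk_of s x (a # w) = (x, a) # walk_of s (s x a) w"

lemma length_walk_of [simp]: "length (walk_of s x w) = length w"
  by (induction w arbitrary: x) auto

lemma map_snd_walk_of [simp]: "map snd (walk_of s x w) = w"
  by (induction w arbitrary: x) auto

lemma walk_of_append: "walk_of s x (u @ v) = walk_of s x u @ walk_of s (foldl s x u) v"
  by (induction u arbitrary: x) auto

lemma cas_iff_walk_of: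
  assumes "tail G = fst" "head G = (\<lambda>(x, a). s x a)"
  shows "pre_digraph.cas G u p v \<longleftrightarrow> p = walk_of s u (map snd p) \<and> v = foldl s u (map snd p)"
proof (induction p arbitrary: u)
  case Nil
  then show ?case by (auto simp: pre_digraph.cas.simps)
next
  case (Cons e p)
  obtain x a where "e = (x, a)" by (cases e)
  then show ?case
    by (cases "x = u") (simp_all add: pre_digraph.cas.simps assms Cons.IH)
qed

lemma awalk_walk_of_iff:
  assumes "tail G = fst" "head G = (\<lambda>(x, a). s x a)"
  shows "pre_digraph.awalk G u (walk_of s u w) v \<longleftrightarrow>
    u \<in> verts G \<and> set (walk_of s u w) \<subseteq> arcs G \<and> v = foldl s u w"
  by (auto simp: pre_digraph.awalk_def cas_iff_walk_of[OF assms])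

text \<open>The reversal of an arc starts where the next arc of the walk starts, so the labels alone
  decide whether the walk turns back.\<close>

lemma walk_of_nonbacktracking_iff:
  "successively (\<lambda>e f. f \<noteq> (s (fst e) (snd e), letter_inv (snd e))) (walk_of s x w) \<longleftrightarrow>
   freely_reduced w"
  unfolding freely_reduced_def
  by (induction w arbitrary: x rule: induct_list012) auto

section \<open>The Cayley graph\<close>

text \<open>Right multiplication by the successive letters of a reduced word never cancels.\<close>

lemma foldl_red_cons:
  "freely_reduced w \<Longrightarrow> foldl (\<lambda>g a. foldr red_cons g [a]) [] w = w"
proof (induction w rule: rev_induct)
  case (snoc a w)
  then have "freely_reduced w"
    by (auto simp: freely_reduced_def successively_append_iff)
  then show ?case
    using snoc foldr_red_cons_Nil[of "w @ [a]"] by simp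
qed simp

lemma length_foldr_red_cons_le: "length (foldr red_cons u v) \<le> length u + length v"
proof (induction u)
  case (Cons x u)
  have "length (red_cons x w) \<le> Suc (length w)" for w
    by (cases w) auto
  then show ?case using Cons le_trans by fastforce
qed simp

text \<open>Each arc multiplies by one letter and so lengthens the word by at most one. This gives
  the lower bound for distances from the identity.\<close>

lemma cayley_awalk_length:
  "pre_digraph.cas (cayley_graph A) u p v \<Longrightarrow> length v \<le> length u + length p"
proof (induction p arbitrary: u)
  case (Cons e p)
  then show ?case
    using length_foldr_red_cons_le[of "fst e" "[snd e]"]
    by (cases e) (fastforce simp: pre_digraph.cas.simps cayley_graph_def free_group_def)
qed (simp add: pre_digraph.cas.simps)

lemma cayley_graph_dist:
  assumes "w \<in> carrier (free_group A)"
  shows "graph_dist (cayley_graph A) [] w = enat (length w)"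
proof (rule antisym)
  let ?s = "\<lambda>g a. foldr red_cons g [a]"
  have w: "set w \<subseteq> letters A" "freely_reduced w"
    using assms by (auto simp: free_group_def)
  have "set (walk_of ?s u w) \<subseteq> arcs (cayley_graph A)" if "u \<in> carrier (free_group A)" for u
    using that w(1)
  proof (induction w arbitrary: u)
    case (Cons a w)
    have "[a] \<in> carrier (free_group A)"
      using Cons.prems by (auto simp: free_group_def freely_reduced_def)
    then have "?s u a \<in> carrier (free_group A)"
      using Cons.prems monoid.m_closed[OF group.is_monoid[OF group_free_group], of u A "[a]"]
      by (simp add: free_group_def)
    then show ?case
      using Cons by (auto simp: cayley_graph_def)
  qed simp
  moreover have "[] \<in> carrier (free_group A)"
    by (simp add: free_group_def)
  ultimately have "pre_digraph.awalk (cayley_graph A) [] (walk_of ?s [] w) w"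
    using w(2) by (subst awalk_walk_of_iff) (auto simp: cayley_graph_def free_group_def foldl_red_cons)
  then show "graph_dist (cayley_graph A) [] w \<le> enat (length w)"
    using graph_dist_le by fastforce
  show "enat (length w) \<le> graph_dist (cayley_graph A) [] w"
    unfolding graph_dist_def
    by (intro INF_greatest) (auto simp: pre_digraph.awalk_def dest: cayley_awalk_length)
qed

lemma cayley_graph_sphere:
  "graph_sphere (cayley_graph A) \<one>\<^bsub>free_group A\<^esub> n = {w \<in> carrier (free_group A). length w = n}"
proof -
  have "\<one>\<^bsub>free_group A\<^esub> = []" "verts (cayley_graph A) = carrier (free_group A)"
    by (simp_all add: free_group_def cayley_graph_def)
  then show ?thesis
    by (auto simp: graph_sphere_def cayley_graph_dist)
qed

section \<open>The uniform measure\<close>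

lemma begins_with_iff: "begins_with \<xi> w \<longleftrightarrow> map \<xi> [0..<length w] = w"
  unfolding begins_with_def list_eq_iff_nth_eq by simp

lemma prefix_in_free_group:
  assumes "\<xi> \<in> boundary A"
  shows "map \<xi> [0..<n] \<in> carrier (free_group A)"
proof -
  have "freely_reduced (map \<xi> [0..<n])"
    unfolding freely_reduced_def using assms
    by (auto simp: successively_conv_nth boundary_def)
  then show ?thesis
    using assms by (auto simp: free_group_def boundary_def)
qed

lemma openin_cylinder:
  "openin (boundary_topology A) {\<xi> \<in> boundary A. begins_with \<xi> w}"
proof -
  let ?P = "product_topology (\<lambda>_. discrete_topology (letters A)) (UNIV :: nat set)"
  \<comment> \<open>Intersecting with \<open>letters A\<close> keeps the set open in the discrete
    factor even if \<open>w ! i\<close> is not a letter over \<open>A\<close>.\<close>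
  have "openin ?P {\<xi> \<in> topspace ?P. \<xi> i \<in> {w ! i} \<inter> letters A}" for i
    by (rule openin_continuous_map_preimage[OF continuous_map_product_projection]) auto
  \<comment> \<open>The factor \<open>topspace ?P\<close> covers the empty word, where the
    intersection over \<open>i\<close> is \<open>UNIV\<close>.\<close>
  then have "openin ?P (topspace ?P \<inter> (\<Inter>i<length w. {\<xi> \<in> topspace ?P. \<xi> i \<in> {w ! i} \<inter> letters A}))"
  by (intro openin_Int_Inter openin_topspace) auto
  moreover have "{\<xi> \<in> boundary A. begins_with \<xi> w} =
      (topspace ?P \<inter> (\<Inter>i<length w. {\<xi> \<in> topspace ?P. \<xi> i \<in> {w ! i} \<inter> letters A})) \<inter> boundary A"
    by (auto simp: boundary_def begins_with_def PiE_def Pi_def extensional_def simp del: split_paired_All)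
  ultimately show ?thesis
    unfolding boundary_topology_def openin_subtopology by blast
qed

context
  fixes A :: "'a set" and M :: "(nat \<Rightarrow> 'a letter) measure"
  assumes finA: "finite A" and unif: "is_uniform_measure A M"
begin

lemma sets_cylinder: "{\<xi> \<in> boundary A. begins_with \<xi> w} \<in> sets M"
  using unif openin_cylinder[of A w] unfolding is_uniform_measure_def
  by (metis (no_types, lifting) mem_Collect_eq sigma_sets.Basic)

text \<open>The event is a finite disjoint union of cylinders, one for each word of
  \<open>W\<close>, and for \<open>n \<ge> 1\<close> all of them have the same measure.\<close>

lemma
  assumes W: "W \<subseteq> {w \<in> carrier (free_group A). length w = n}"
  shows sets_prefix_in: "{\<xi> \<in> boundary A. map \<xi> [0..<n] \<in> W} \<in> sets M"
    and measure_prefix_in: "n \<ge> 1 \<Longrightarrow> measure M {\<xi> \<in> boundary A. map \<xi> [0..<n] \<in> W} =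
      real (card W) / (2 * real (card A) * (2 * real (card A) - 1) ^ (n - 1))"
proof -
  interpret prob_space M
    using unif by (simp add: is_uniform_measure_def)
  have "finite {w. set w \<subseteq> letters A \<and> length w = n}"
    using finA by (intro finite_lists_length_eq) (simp add: letters_def)
  then have fin: "finite W"
    by (rule finite_subset[rotated]) (use W in \<open>auto simp: free_group_def\<close>)
  have eq: "{\<xi> \<in> boundary A. map \<xi> [0..<n] \<in> W} = (\<Union>w\<in>W. {\<xi> \<in> boundary A. begins_with \<xi> w})"
    using W by (auto simp: begins_with_iff)
  show "{\<xi> \<in> boundary A. map \<xi> [0..<n] \<in> W} \<in> sets M"
    unfolding eq using fin sets_cylinder by (intro sets.finite_UN) auto
  assume n: "n \<ge> 1"
  have "disjoint_family_on (\<lambda>w. {\<xi> \<in> boundary A. begins_with \<xi> w}) W"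
    unfolding disjoint_family_on_def
  proof (intro ballI impI equals0I)
    fix u w \<xi> assume "u \<in> W" "w \<in> W" "u \<noteq> w"
      and \<xi>: "\<xi> \<in> {\<xi> \<in> boundary A. begins_with \<xi> u} \<inter> {\<xi> \<in> boundary A. begins_with \<xi> w}"
    then have "length u = length w"
      using W by auto
    then show False
      using \<xi> \<open>u \<noteq> w\<close> unfolding begins_with_iff by auto
  qed
  then have "measure M {\<xi> \<in> boundary A. map \<xi> [0..<n] \<in> W} =
      (\<Sum>w\<in>W. measure M {\<xi> \<in> boundary A. begins_with \<xi> w})"
    unfolding eq using fin sets_cylinder by (intro finite_measure_finite_Union) auto
  also have "\<dots> = (\<Sum>w\<in>W. 1 / (2 * real (card A) * (2 * real (card A) - 1) ^ (n - 1)))"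
  proof (rule sum.cong)
    fix w assume "w \<in> W"
    then have "w \<in> carrier (free_group A)" "length w = n" "w \<noteq> \<one>\<^bsub>free_group A\<^esub>"
      using W n by (auto simp: free_group_def)
    then show "measure M {\<xi> \<in> boundary A. begins_with \<xi> w} =
        1 / (2 * real (card A) * (2 * real (card A) - 1) ^ (n - 1))"
      using unif by (simp add: is_uniform_measure_def)
  qed simp
  finally show "measure M {\<xi> \<in> boundary A. map \<xi> [0..<n] \<in> W} =
      real (card W) / (2 * real (card A) * (2 * real (card A) - 1) ^ (n - 1))"
    by simp
qed

text \<open>The sphere is counted by applying the measure to the whole boundary.\<close>

lemma card_free_group_sphere:
  assumes "n \<ge> 1"
  shows "real (card {w \<in> carrier (free_group A). length w = n}) =
    2 * real (card A) * (2 * real (card A) - 1) ^ (n - 1)"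
proof -
  interpret prob_space M
    using unif by (simp add: is_uniform_measure_def)
  let ?W = "{w \<in> carrier (free_group A). length w = n}"
  have "{\<xi> \<in> boundary A. map \<xi> [0..<n] \<in> ?W} = space M"
    using unif prefix_in_free_group by (auto simp: is_uniform_measure_def)
  then have "real (card ?W) / (2 * real (card A) * (2 * real (card A) - 1) ^ (n - 1)) = 1"
    using measure_prefix_in[OF order_refl assms] prob_space by (simp only:)
  \<comment> \<open>A zero denominator would make the quotient 0, so a quotient equal to 1 gives the
    equality.\<close>
  then show ?thesis
    by simp
qed

end

section \<open>The Schreier graph\<close>

context
  fixes A :: "'a set" and H :: "'a letter list set"
    and T :: "('a letter list set, 'a schreier_edge) pre_digraph"
  assumes subgr: "subgroup H (free_group A)"
    and tree: "geodesic_spanning_tree A H T"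
begin

abbreviation (input) "F \<equiv> free_group A"
abbreviation (input) "X \<equiv> schreier_graph A H"

abbreviation step :: "'a letter list set \<Rightarrow> 'a letter \<Rightarrow> 'a letter list set" where
  "step x a \<equiv> x #>\<^bsub>free_group A\<^esub> [a]"

interpretation group "free_group A"
  by (rule group_free_group)

section \<open>Steps between cosets\<close>

lemma letter_in_free_group: "a \<in> letters A \<Longrightarrow> [a] \<in> carrier F"
  by (simp add: free_group_def freely_reduced_def)

lemma root_in_verts: "H \<in> verts X"
  using subgr by (simp add: schreier_graph_def subgroup.subgroup_in_rcosets group_free_group)

lemma step_in_verts:
  assumes "x \<in> verts X" "a \<in> letters A"
  shows "step x a \<in> verts X"
proof -
  have H: "H \<subseteq> carrier F" by (rule subgroup.subset[OF subgr])
  obtain g where "g \<in> carrier F" "x = H #>\<^bsub>F\<^esub> g"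
    using assms(1) by (auto simp: schreier_graph_def RCOSETS_def)
  then show ?thesis
    using H letter_in_free_group[OF assms(2)]
    by (simp add: schreier_graph_def coset_mult_assoc rcosetsI)
qed

lemma step_inverse:
  assumes "x \<in> verts X" "a \<in> letters A"
  shows "step (step x a) (letter_inv a) = x"
proof -
  have "x \<subseteq> carrier F"
    using assms(1) subgroup.rcosets_carrier[OF subgr group_free_group]
    by (simp add: schreier_graph_def)
  moreover have "[a] \<otimes>\<^bsub>F\<^esub> [letter_inv a] = \<one>\<^bsub>F\<^esub>"
    by (simp add: free_group_def)
  ultimately show ?thesis
    using letter_in_free_group[OF assms(2)] letter_in_free_group[of "letter_inv a"] assms(2)
    by (simp add: coset_mult_assoc)
qed

lemma foldl_step: "w \<in> carrier F \<Longrightarrow> foldl step H w = H #>\<^bsub>F\<^esub> w"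
proof (induction w rule: rev_induct)
  case Nil
  show ?case
    using coset_mult_one[OF subgroup.subset[OF subgr]] by (simp add: free_group_def)
next
  case (snoc a w)
  then have red: "w \<in> carrier F" "[a] \<in> carrier F"
    by (auto simp: free_group_def freely_reduced_def successively_append_iff)
  have "w \<otimes>\<^bsub>F\<^esub> [a] = w @ [a]"
    using snoc.prems foldr_red_cons_Nil[of "w @ [a]"] by (simp add: free_group_def)
  then show ?case
    using snoc.IH red subgroup.subset[OF subgr] by (simp add: coset_mult_assoc)
qed

lemma set_walk_of_step:
  assumes "x \<in> verts X" "set w \<subseteq> letters A"
  shows "set (walk_of step x w) \<subseteq> arcs X" "foldl step x w \<in> verts X"
  using assms
  by (induction w arbitrary: x) (auto simp: step_in_verts, auto simp: schreier_graph_def)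

lemma tail_X: "tail X = fst" and head_X: "head X = (\<lambda>(x, a). step x a)"
  by (simp_all add: schreier_graph_def)

section \<open>The spanning tree as a graph with edge reversal\<close>

lemma subgraph_T: "subgraph T X" and verts_T: "verts T = verts X"
  using tree by (auto simp: geodesic_spanning_tree_def spanning_tree_of_def spanning_def)

lemma tail_T: "tail T = fst" and head_T: "head T = (\<lambda>(x, a). step x a)"
  using subgraph_T by (auto simp: subgraph_def compatible_def tail_X head_X)

lemma arcs_T: "arcs T \<subseteq> arcs X"
  using subgraph_T by (simp add: subgraph_def)

interpretation T: involutive_digraph T "schreier_reversal A"
proof -
  interpret wf_digraph T
    using subgraph_T by (simp add: subgraph_def)
  show "involutive_digraph T (schreier_reversal A)"
  proof
    fix e assume e: "e \<in> arcs T"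
    show "schreier_reversal A e \<in> arcs T"
      using tree e by (simp add: geodesic_spanning_tree_def spanning_tree_of_def)
    obtain x a where "e = (x, a)" "x \<in> verts X" "a \<in> letters A"
      using e arcs_T by (cases e) (auto simp: schreier_graph_def)
    then show "schreier_reversal A (schreier_reversal A e) = e"
      and "tail T (schreier_reversal A e) = head T e"
      by (simp_all add: schreier_reversal_def step_inverse tail_T head_T)
  qed
qed

lemma circuit_free: "\<nexists>c. circuit T (schreier_reversal A) c"
  using tree by (simp add: geodesic_spanning_tree_def spanning_tree_of_def)

text \<open>A Schreier transversal of \<open>H\<close>: a set of reduced coset representatives, one
  for each coset, that is closed under prefixes.\<close>

definition tree_words :: "'a letter list set" where
  "tree_words = {w. freely_reduced w \<and> set (walk_of step H w) \<subseteq> arcs T}"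

lemma nonbacktracking_walk_of: "T.nonbacktracking (walk_of step x w) \<longleftrightarrow> freely_reduced w"
  using walk_of_nonbacktracking_iff[of step x w]
  by (simp add: schreier_reversal_def case_prod_beta)

lemma geodesic_tree_word:
  assumes "w \<in> tree_words"
  shows "geodesic T H (walk_of step H w) (foldl step H w)"
  using assms root_in_verts
  by (simp add: T.geodesic_iff_nonbacktracking[OF circuit_free] nonbacktracking_walk_of
      awalk_walk_of_iff[OF tail_T head_T] verts_T tree_words_def)

text \<open>Converse to \<open>geodesic_tree_word\<close>: the tree words are exactly the label
  words of the geodesics of \<open>T\<close> from the root.\<close>

lemma geodesicE:
  assumes "geodesic T H p x"
  obtains w where "w \<in> tree_words" "p = walk_of step H w" "x = foldl step H w"
proof -
  from assms have p: "T.awalk H p x" "T.nonbacktracking p"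
    by (simp_all add: T.geodesic_iff_nonbacktracking[OF circuit_free])
  then have eq: "p = walk_of step H (map snd p)" "x = foldl step H (map snd p)"
    unfolding T.awalk_def cas_iff_walk_of[OF tail_T head_T] by blast+
  have "freely_reduced (map snd p)"
    using p(2) eq(1) nonbacktracking_walk_of by metis
  moreover have "set (walk_of step H (map snd p)) \<subseteq> arcs T"
    using p(1) eq(1) by (metis T.awalk_def)
  ultimately have "map snd p \<in> tree_words"
    by (simp add: tree_words_def)
  then show thesis
    using eq by (rule that)
qed

lemma tree_words_inj:
  assumes "v \<in> tree_words" "w \<in> tree_words" "foldl step H v = foldl step H w"
  shows "v = w"
proof -
  have "geodesic T H (walk_of step H v) (foldl step H w)" "geodesic T H (walk_of step H w) (foldl step H w)"
    using geodesic_tree_word[OF assms(1)] geodesic_tree_word[OF assms(2)] unfolding assms(3) .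
  then have "walk_of step H v = walk_of step H w"
    unfolding T.geodesic_iff_nonbacktracking[OF circuit_free]
    using T.nonbacktracking_walk_unique[OF circuit_free] by blast
  then show ?thesis by (metis map_snd_walk_of)
qed

lemma dist_eq: "x \<in> verts X \<Longrightarrow> graph_dist T H x = graph_dist X H x"
  using tree by (simp add: geodesic_spanning_tree_def)

text \<open>Reading any representative \<open>g\<close> of the coset from the root gives a walk to
  it in \<open>X\<close>.\<close>

lemma dist_finite:
  assumes "x \<in> verts X"
  shows "graph_dist X H x \<noteq> \<infinity>"
proof -
  obtain g where g: "g \<in> carrier F" "x = H #>\<^bsub>F\<^esub> g"
    using assms by (auto simp: schreier_graph_def RCOSETS_def)
  then have "pre_digraph.awalk X H (walk_of step H g) x"
    using set_walk_of_step(1)[OF root_in_verts, of g] foldl_step root_in_verts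
    by (simp add: awalk_walk_of_iff[OF tail_X head_X]) (simp add: free_group_def)
  then show ?thesis
    using graph_dist_le[of X H _ x] by (metis enat_ord_code(5))
qed

text \<open>Finiteness of the distance passes from \<open>X\<close> to \<open>T\<close> because
  \<open>T\<close> is geodesic; the labels of a geodesic in \<open>T\<close> then form the
  word.\<close>

lemma tree_word_exists:
  assumes "x \<in> verts X"
  shows "\<exists>w\<in>tree_words. x = foldl step H w"
proof -
  have "graph_dist T H x \<noteq> \<infinity>"
    using assms dist_eq dist_finite by simp
  then obtain p where "geodesic T H p x"
    using geodesic_exists[of T H x] by blast
  then show ?thesis
    by (blast elim: geodesicE)
qed

lemma tree_words_subset: "tree_words \<subseteq> carrier F"
proof
  fix w assume w: "w \<in> tree_words"
  have "snd ` set (walk_of step H w) \<subseteq> letters A"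
    using w arcs_T by (auto simp: tree_words_def schreier_graph_def)
  then show "w \<in> carrier F"
    using w by (simp add: tree_words_def free_group_def flip: set_map)
qed

text \<open>The length of a tree word is a distance in \<open>T\<close>, which the geodesic property
  turns into a distance in \<open>X\<close>.\<close>

lemma dist_tree_word:
  assumes "w \<in> tree_words"
  shows "foldl step H w \<in> verts X" "graph_dist X H (foldl step H w) = enat (length w)"
proof -
  show x: "foldl step H w \<in> verts X"
    using assms tree_words_subset root_in_verts
    by (intro set_walk_of_step) (auto simp: free_group_def)
  have "geodesic T H (walk_of step H w) (foldl step H w)"
    using assms by (rule geodesic_tree_word)
  then show "graph_dist X H (foldl step H w) = enat (length w)"
    using dist_eq[OF x] by (simp add: geodesic_def)
qed

lemma bij_betw_sphere:
  "bij_betw (foldl step H) {w \<in> tree_words. length w = n} (graph_sphere X H n)"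
proof -
  have "foldl step H ` {w \<in> tree_words. length w = n} = graph_sphere X H n"
    using dist_tree_word tree_word_exists by (force simp: graph_sphere_def)
  then show ?thesis
    using tree_words_inj by (auto simp: bij_betw_def inj_on_def)
qed

section \<open>The fundamental domain in terms of tree words\<close>

lemma sigma_minus_tree_word:
  assumes "w \<in> tree_words" "x = foldl step H w"
  shows "sigma_minus H T (x, b) = w"
proof -
  have "(THE p. geodesic T H p x) = walk_of step H w"
  proof (rule the_equality)
    show "geodesic T H (walk_of step H w) x"
      unfolding assms(2) using assms(1) by (rule geodesic_tree_word)
    fix p assume "geodesic T H p x"
    then obtain v where v: "v \<in> tree_words" "p = walk_of step H v" "x = foldl step H v"
      by (rule geodesicE)
    have "v = w"
      using v(1) assms(1) v(3)[symmetric] unfolding assms(2) by (rule tree_words_inj)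
    then show "p = walk_of step H w"
      using v(2) by simp
  qed
  then show ?thesis by (simp add: sigma_minus_def)
qed

lemma tree_words_butlast: "w @ [b] \<in> tree_words \<Longrightarrow> w \<in> tree_words"
  by (auto simp: tree_words_def walk_of_append freely_reduced_def successively_append_iff)

text \<open>The first edge outside the tree on the walk reading an infinite word completes a forbidden
  beginning.\<close>

lemma schreier_domain_eq:
  "schreier_domain A H T = (\<Inter>n. {\<xi> \<in> boundary A. map \<xi> [0..<n] \<in> tree_words})"
proof (intro equalityI subsetI)
  fix \<xi> assume \<xi>: "\<xi> \<in> schreier_domain A H T"
  then have bd: "\<xi> \<in> boundary A" by (simp add: schreier_domain_def)
  have "map \<xi> [0..<n] \<in> tree_words" for n
  proof (induction n)
    case 0
    then show ?case by (simp add: tree_words_def)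
  next
    case (Suc n)
    let ?w = "map \<xi> [0..<n]" and ?x = "foldl step H (map \<xi> [0..<n])"
    \<comment> \<open>The prefix read so far is a tree word, hence it is \<open>sigma_minus\<close>
      of the edge about to be traversed. Were this edge outside \<open>T\<close>, the beginning of
      \<xi> would be forbidden.\<close>
    have "begins_with \<xi> (sigma_minus H T (?x, \<xi> n) @ [sigma_zero (?x, \<xi> n)])"
      using sigma_minus_tree_word[OF Suc refl] by (simp add: begins_with_iff sigma_zero_def)
    moreover have "(?x, \<xi> n) \<in> arcs X"
      using dist_tree_word(1)[OF Suc] bd by (simp add: schreier_graph_def boundary_def)
    ultimately have "(?x, \<xi> n) \<in> arcs T"
      using \<xi> by (auto simp: schreier_domain_def)
    moreover have "freely_reduced (map \<xi> [0..<Suc n])"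
      using prefix_in_free_group[OF bd] by (auto simp: free_group_def simp del: upt_Suc)
    ultimately show ?case
      using Suc by (simp add: tree_words_def walk_of_append)
  qed
  then show "\<xi> \<in> (\<Inter>n. {\<xi> \<in> boundary A. map \<xi> [0..<n] \<in> tree_words})"
    using bd by simp
next
  fix \<xi> assume \<xi>: "\<xi> \<in> (\<Inter>n. {\<xi> \<in> boundary A. map \<xi> [0..<n] \<in> tree_words})"
  have "\<not> begins_with \<xi> (sigma_minus H T e @ [sigma_zero e])" if e: "e \<in> arcs X - arcs T" for e
  proof
    obtain x b where xb: "e = (x, b)" by (cases e)
    then obtain w where w: "w \<in> tree_words" "x = foldl step H w"
      using e tree_word_exists[of x] by (auto simp: schreier_graph_def)
    assume "begins_with \<xi> (sigma_minus H T e @ [sigma_zero e])"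
    then have "map \<xi> [0..<Suc (length w)] = w @ [b]"
      using sigma_minus_tree_word[OF w] by (simp add: begins_with_iff xb sigma_zero_def)
    \<comment> \<open>The hypothesis on \<xi> is used at index \<open>Suc (length w)\<close>; the
      last arc of this tree walk is \<open>e\<close> itself.\<close>
    then have "w @ [b] \<in> tree_words"
      using \<xi> by (metis (no_types, lifting) INT_iff UNIV_I mem_Collect_eq)
    then show False
      using e xb w by (simp add: tree_words_def walk_of_append)
  qed
  then show "\<xi> \<in> schreier_domain A H T"
    using \<xi> by (simp add: schreier_domain_def)
qed

lemma decseq_tree_prefix: "decseq (\<lambda>n. {\<xi> \<in> boundary A. map \<xi> [0..<n] \<in> tree_words})"
  by (intro decseq_SucI) (auto dest: tree_words_butlast)

end

theorem theorem4p10: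
  fixes A :: "'a set" and m :: nat
    and H :: "'a letter list set"
    and T :: "('a letter list set, 'a schreier_edge) pre_digraph"
    and \<mm> :: "(nat \<Rightarrow> 'a letter) measure"
    and a :: "nat \<Rightarrow> real"
  assumes "finite A" and "card A = m" and "m \<ge> 2"
    and "is_uniform_measure A \<mm>"
    and "subgroup H (free_group A)" and "H \<noteq> {\<one>\<^bsub>free_group A\<^esub>}"
    and "geodesic_spanning_tree A H T"
  defines "a \<equiv> \<lambda>n. real (card (graph_sphere (schreier_graph A H) H n)) /
                   real (card (graph_sphere (cayley_graph A) \<one>\<^bsub>free_group A\<^esub> n))"
  shows "(\<forall>n\<ge>1. a n = real (card (graph_sphere (schreier_graph A H) H n)) /
                       (2 * real m * (2 * real m - 1) ^ (n - 1))) \<and>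
         antimono_on {1..} a \<and>
         a \<longlonglongrightarrow> measure \<mm> (schreier_domain A H T)"
proof -
  interpret prob_space \<mm>
    using assms(4) by (simp add: is_uniform_measure_def)
  note ctx = assms(5,7)
  let ?\<Omega> = "\<lambda>n. {\<xi> \<in> boundary A. map \<xi> [0..<n] \<in> tree_words A H T}"
  \<comment> \<open>Prefixes of length \<open>n\<close> only meet tree words of length
    \<open>n\<close>; this form fits \<open>measure_prefix_in\<close> and
    \<open>bij_betw_sphere\<close>.\<close>
  have \<Omega>: "?\<Omega> n = {\<xi> \<in> boundary A. map \<xi> [0..<n] \<in> {w \<in> tree_words A H T. length w = n}}" for n
    by auto
  have sub: "{w \<in> tree_words A H T. length w = n} \<subseteq> {w \<in> carrier (free_group A). length w = n}" for n
    using tree_words_subset[OF ctx] by auto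
  have sets: "?\<Omega> n \<in> sets \<mm>" for n
    unfolding \<Omega> by (rule sets_prefix_in[OF assms(1,4) sub])
  have formula: "a n = real (card (graph_sphere (schreier_graph A H) H n)) /
      (2 * real m * (2 * real m - 1) ^ (n - 1))" if "n \<ge> 1" for n
    using card_free_group_sphere[OF assms(1,4) that] assms(2)
    by (simp add: a_def cayley_graph_sphere)
  have a_measure: "a n = measure \<mm> (?\<Omega> n)" if "n \<ge> 1" for n
    using formula[OF that] measure_prefix_in[OF assms(1,4) sub that] assms(2)
      bij_betw_same_card[OF bij_betw_sphere[OF ctx, of n]]
    unfolding \<Omega> by simp
  \<comment> \<open>Continuity from above of the finite measure along the decreasing sets.\<close>
  have "(\<lambda>n. measure \<mm> (?\<Omega> n)) \<longlonglongrightarrow> measure \<mm> (schreier_domain A H T)"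
    unfolding schreier_domain_eq[OF ctx]
    using sets by (intro finite_Lim_measure_decseq decseq_tree_prefix[OF ctx]) auto
  then have "a \<longlonglongrightarrow> measure \<mm> (schreier_domain A H T)"
    \<comment> \<open>The identity \<open>a_measure\<close> holds from index 1 on, which suffices
      for the limit.\<close>
    by (rule Lim_transform_eventually)
      (use a_measure in \<open>auto simp: eventually_sequentially intro!: exI[of _ 1]\<close>)
  moreover have "antimono_on {1..} a"
  proof (rule monotone_onI)
    fix i j :: nat assume "i \<in> {1..}" "j \<in> {1..}" "i \<le> j"
    then show "a j \<le> a i"
      using finite_measure_mono[OF decseqD[OF decseq_tree_prefix[OF ctx]] sets] a_measure by simp
  qed
  ultimately show ?thesis
    using formula by blast
qed

end
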